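(* For every integer $N > 2$, $\theta(J(N,2)) = N-2$.
   Context: For integers $0<k<N$, let $[N]=\{1,\dots,N\}$ and let $\mathcal{P}_k([N])$ be the set of $k$-element subsets of $[N]$. The Johnson graph $J(N,k)$ has vertex set $\mathcal{P}_k([N])$, two vertices $S_1,S_2$ being adjacent iff $|S_1\cap S_2| = k-1$. A (vertex) clique cover of a graph $G$ is a collection of cliques of $G$ whose vertex sets together contain every vertex of $G$; $\theta(G)$ denotes the smallest cardinality of a clique cover of $G$. *)

theory Defs
  imports "Graph_Theory.Pair_Digraph"
begin

text \<open>
  As usual in the Graph-Theory library, a finite simple graph is a finite loop-free digraph whose
  arc relation is symmetric (\<^locale>\<open>pair_graph\<close>); the edge joining \<open>u\<close> and \<open>v\<close> is represented
  by the two arcs \<open>(u, v)\<close> and \<open>(v, u)\<close>.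
\<close>

definition johnson_graph :: "nat \<Rightarrow> nat \<Rightarrow> nat set pair_pre_digraph" where
  "johnson_graph N k =
    \<lparr> pverts = {S. S \<subseteq> {1..N} \<and> card S = k},
      parcs = {(S, T). S \<subseteq> {1..N} \<and> card S = k \<and> T \<subseteq> {1..N} \<and> card T = k
                      \<and> card (S \<inter> T) = k - 1} \<rparr>"

text \<open>
  For \<open>k = 0\<close> the truncated subtraction would create a loop, hence the assumption below.
\<close>

lemma pair_graph_johnson_graph:
  assumes "0 < k"
  shows "pair_graph (johnson_graph N k)"
proof -
  let ?G = "johnson_graph N k"
  have "pverts ?G \<subseteq> Pow {1..N}"
    by (auto simp: johnson_graph_def)
  then have V: "finite (pverts ?G)"
    by (rule finite_subset) simp
  have wf: "parcs ?G \<subseteq> pverts ?G \<times> pverts ?G"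
    by (auto simp: johnson_graph_def)
  then have A: "finite (parcs ?G)"
    by (rule finite_subset) (simp add: V)
  have sym: "sym (parcs ?G)"
    by (simp add: johnson_graph_def sym_def Int_commute)
  have irrefl: "u \<noteq> v" if "(u, v) \<in> parcs ?G" for u v
    using that assms by (auto simp: johnson_graph_def)
  show ?thesis
  proof
    show "fst e \<noteq> snd e" if "e \<in> parcs ?G" for e
      using irrefl[of "fst e" "snd e"] that by simp
  qed (use V A wf sym in \<open>auto simp: symmetric_def arcs_ends_conv\<close>)
qed

definition is_clique :: "'a pair_pre_digraph \<Rightarrow> 'a set \<Rightarrow> bool" where
  "is_clique G K \<longleftrightarrow> K \<subseteq> pverts G \<and> (\<forall>u\<in>K. \<forall>v\<in>K. u \<noteq> v \<longrightarrow> (u, v) \<in> parcs G)"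

definition is_clique_cover :: "'a pair_pre_digraph \<Rightarrow> 'a set set \<Rightarrow> bool" where
  "is_clique_cover G C \<longleftrightarrow> (\<forall>K\<in>C. is_clique G K) \<and> \<Union>C = pverts G"

text \<open>
  Finiteness is required because \<^const>\<open>card\<close> of an infinite set is \<open>0\<close>; on a finite graph every
  clique cover is finite.
\<close>

definition clique_cover_number :: "'a pair_pre_digraph \<Rightarrow> nat" (\<open>\<theta>\<close>) where
  "\<theta> G = (LEAST n. \<exists>C. is_clique_cover G C \<and> finite C \<and> card C = n)"

lemma clique_cover_number_attained:
  assumes "finite (pverts G)"
  shows "\<exists>C. is_clique_cover G C \<and> finite C \<and> card C = \<theta> G"
  unfolding clique_cover_number_def
proof (rule LeastI_ex)
  have "is_clique_cover G ((\<lambda>v. {v}) ` pverts G)"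
    by (auto simp: is_clique_cover_def is_clique_def)
  with assms show "\<exists>n C. is_clique_cover G C \<and> finite C \<and> card C = n"
    by blast
qed

end

theory Submission
  imports Defs
begin

text \<open>
  A clique of \<open>J(N,2)\<close> is an intersecting family of edges of \<open>K\<^sub>N\<close>: a substar or a subset of a triangle.
  The stars at \<open>4, \<dots>, N\<close> and the triangle on \<open>{1, 2, 3}\<close> form a cover of size \<open>N - 2\<close>.
  Conversely, if all but \<open>m\<close> points are centres of stars of a given cover, then triangles must cover
  the \<open>m choose 2\<close> edges on these \<open>m\<close> points, so there are at least \<open>(m choose 2) / 3\<close> of them;
  this is at least \<open>m - 2\<close>, because \<open>(m - 3) (m - 4) \<ge> 0\<close> for every integer \<open>m\<close>.
\<close>

text \<open>If no point is common to all members, some \<open>S = {a, b}\<close> is accompanied by a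
  \<open>T\<close> avoiding \<open>a\<close> and a \<open>U\<close> avoiding \<open>b\<close>.
  Intersection forces \<open>T = {b, c}\<close> and \<open>U = {a, c}\<close>, and a pair meeting
  all three sides of this triangle is itself a side. An empty \<open>K\<close> falls under
  \<open>star\<close>.\<close>

lemma intersecting_pairs_cases:
  assumes card2: "\<And>S. S \<in> K \<Longrightarrow> card S = 2"
    and meet: "\<And>S T. S \<in> K \<Longrightarrow> T \<in> K \<Longrightarrow> S \<inter> T \<noteq> {}"
  obtains (star) a where "\<And>S. S \<in> K \<Longrightarrow> a \<in> S"
  | (triangle) a b c where "K \<subseteq> {{a, b}, {a, c}, {b, c}}"
proof (cases "\<exists>a. \<forall>S\<in>K. a \<in> S")
  case True
  then show ?thesis using star by blast
next
  case False
  then obtain S where S: "S \<in> K" by blast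
  obtain a b where ab: "S = {a, b}" "a \<noteq> b"
    using card2[OF S] by (auto simp: card_2_iff)
  obtain T where T: "T \<in> K" "a \<notin> T" using False by blast
  have "b \<in> T" using meet[OF S T(1)] T ab by auto
  then obtain c where c: "T = {b, c}" "b \<noteq> c"
    using card2[OF T(1)] by (auto simp: card_2_iff)
  obtain U where U: "U \<in> K" "b \<notin> U" using False by blast
  have "a \<in> U" "c \<in> U" using meet[OF S U(1)] meet[OF T(1) U(1)] U ab c by auto
  have "a \<noteq> c" using T(2) c(1) by auto
  have U_eq: "U = {a, c}"
  proof -
    obtain x y where "U = {x, y}" using card2[OF U(1)] by (auto simp: card_2_iff)
    then show ?thesis using \<open>a \<in> U\<close> \<open>c \<in> U\<close> \<open>a \<noteq> c\<close> by (auto simp: doubleton_eq_iff)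
  qed
  have "W \<in> {{a, b}, {a, c}, {b, c}}" if W: "W \<in> K" for W
  proof -
    obtain x y where xy: "W = {x, y}" "x \<noteq> y"
      using card2[OF W] by (auto simp: card_2_iff)
    have "a \<in> W \<or> b \<in> W" "b \<in> W \<or> c \<in> W" "a \<in> W \<or> c \<in> W"
      using meet[OF S W] meet[OF T(1) W] meet[OF U(1) W] unfolding ab c U_eq by blast+
    then show ?thesis using ab(2) c(2) \<open>a \<noteq> c\<close> xy by (auto simp: doubleton_eq_iff)
  qed
  then show ?thesis using triangle by blast
qed

text \<open>Distinct 2-sets that meet share exactly one point. The case \<open>S = T\<close> may be
  included because a 2-set meets itself.\<close>

lemma is_clique_johnson_graph_2_iff:
  "is_clique (johnson_graph N 2) K \<longleftrightarrow>
    (\<forall>S\<in>K. S \<subseteq> {1..N} \<and> card S = 2) \<and> (\<forall>S\<in>K. \<forall>T\<in>K. S \<inter> T \<noteq> {})"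
proof -
  have meet_iff: "(S \<noteq> T \<longrightarrow> card (S \<inter> T) = 1) \<longleftrightarrow> S \<inter> T \<noteq> {}"
    if "card S = 2" "card T = 2" for S T :: "nat set"
  proof (cases "S = T")
    case True
    then show ?thesis using that by auto
  next
    case False
    then show ?thesis using that by (auto simp: card_2_iff card_1_singleton_iff)
  qed
  show ?thesis
  proof (cases "\<forall>S\<in>K. S \<subseteq> {1..N} \<and> card S = 2")
    case True
    then have "is_clique (johnson_graph N 2) K \<longleftrightarrow>
        (\<forall>S\<in>K. \<forall>T\<in>K. S \<noteq> T \<longrightarrow> card (S \<inter> T) = 1)"
      by (simp add: is_clique_def johnson_graph_def subset_eq[of K])
    also have "\<dots> \<longleftrightarrow> (\<forall>S\<in>K. \<forall>T\<in>K. S \<inter> T \<noteq> {})"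
      using True by (intro ball_cong refl meet_iff) auto
    finally show ?thesis using True by simp
  next
    case False
    then have "\<not> is_clique (johnson_graph N 2) K"
      by (simp add: is_clique_def johnson_graph_def subset_eq[of K])
    with False show ?thesis by simp
  qed
qed

text \<open>This is \<open>m - 2 \<le> (m choose 2) / 3\<close>, rearranged to avoid truncated
  subtraction and division.\<close>

lemma three_mult_le_choose_two: "3 * m \<le> (m choose 2) + 6"
proof -
  have "(int m - 3) * (int m - 4) \<ge> 0"
    by (cases "m \<le> 3") (auto simp: zero_le_mult_iff)
  moreover have "2 * int (m choose 2) = int m * (int m - 1)"
    by (induction m) (auto simp: numeral_2_eq_2 algebra_simps)
  ultimately show ?thesis by (simp add: algebra_simps)
qed

lemma clique_cover_johnson_graph_2_card_ge:
  assumes cover: "is_clique_cover (johnson_graph N 2) C" and fin: "finite C"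
  shows "N - 2 \<le> card C"
proof -
  \<comment> \<open>\<open>A\<close> collects the substars, \<open>f\<close> picks a centre of each,
    and \<open>M\<close> is the set of points not picked. For an empty clique \<open>f\<close> is
    arbitrary, possibly outside \<open>{1..N}\<close>; the bound on \<open>card M\<close> holds all
    the same.\<close>
  define A where "A = {K \<in> C. \<exists>a. \<forall>S\<in>K. a \<in> S}"
  define f where "f K = (SOME a. \<forall>S\<in>K. a \<in> S)" for K :: "nat set set"
  define M where "M = {1..N} - f ` A"
  have clique: "is_clique (johnson_graph N 2) K" if "K \<in> C" for K
    using cover that by (simp add: is_clique_cover_def)
  have f: "f K \<in> S" if "K \<in> A" "S \<in> K" for K S
    using that someI_ex[of "\<lambda>a. \<forall>S\<in>K. a \<in> S"] by (auto simp: A_def f_def)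
  have A: "finite A" "A \<subseteq> C" using fin by (auto simp: A_def)
  have "N - card A \<le> N - card (f ` A)" using card_image_le[OF A(1)] by (rule diff_le_mono2)
  also have "\<dots> \<le> card M"
    using diff_card_le_card_Diff[of "f ` A" "{1..N}"] A by (simp add: M_def)
  finally have M: "N - card A \<le> card M" .
  have small: "finite K \<and> card K \<le> 3" if K: "K \<in> C - A" for K
  proof (rule intersecting_pairs_cases[of K])
    fix a assume "\<And>S. S \<in> K \<Longrightarrow> a \<in> S"
    then show ?thesis using K by (auto simp: A_def)
  next
    fix a b c assume sub: "K \<subseteq> {{a, b}, {a, c}, {b, c}}"
    have "card K \<le> card {{a, b}, {a, c}, {b, c}}" by (rule card_mono) (use sub in auto)
    also have "\<dots> \<le> 3" by (simp add: card_insert_if)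
    finally show ?thesis using sub by (auto intro: finite_subset)
  qed (use clique[of K] K in \<open>auto simp: is_clique_johnson_graph_2_iff\<close>)
  \<comment> \<open>A member of a substar contains the chosen centre, which is not in
    \<open>M\<close>.\<close>
  have "{S. S \<subseteq> M \<and> card S = 2} \<subseteq> \<Union>(C - A)"
  proof clarify
    fix S assume S: "S \<subseteq> M" "card S = 2"
    then have "S \<in> pverts (johnson_graph N 2)" by (auto simp: johnson_graph_def M_def)
    then obtain K where "K \<in> C" "S \<in> K" using cover by (auto simp: is_clique_cover_def)
    moreover have "K \<notin> A" using f[of K S] S \<open>S \<in> K\<close> by (auto simp: M_def)
    ultimately show "S \<in> \<Union>(C - A)" by blast
  qed
  then have "card {S. S \<subseteq> M \<and> card S = 2} \<le> card (\<Union>(C - A))"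
    using fin small by (intro card_mono) auto
  also have "\<dots> \<le> (\<Sum>K\<in>C - A. card K)"
    using fin card_UN_le[of "C - A" id] by simp
  also have "\<dots> \<le> card (C - A) * 3"
    using sum_bounded_above[of "C - A" card 3] small by simp
  finally have "card M choose 2 \<le> 3 * card (C - A)"
    by (simp add: n_subsets M_def)
  moreover have "card C = card A + card (C - A)"
    using A fin by (metis card_Diff_subset card_mono le_add_diff_inverse)
  \<comment> \<open>With \<open>m = card M\<close> and \<open>t = card (C - A)\<close>:
    \<open>3 * m \<le> 3 * t + 6\<close> gives \<open>m \<le> t + 2\<close>, and
    \<open>N \<le> m + card A\<close>.\<close>
  ultimately show ?thesis
    using M three_mult_le_choose_two[of "card M"] by linarith
qed

text \<open>An upper bound on \<open>card C\<close> suffices since \<open>\<theta>\<close> is a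
  minimum.\<close>

lemma clique_cover_johnson_graph_2_exists:
  assumes "N > 2"
  shows "\<exists>C. is_clique_cover (johnson_graph N 2) C \<and> finite C \<and> card C \<le> N - 2"
proof -
  define star where "star a = {S. S \<subseteq> {1..N} \<and> card S = 2 \<and> a \<in> S}" for a
  define triangle where "triangle = {S. S \<subseteq> {1..3::nat} \<and> card S = 2}"
  define C where "C = insert triangle (star ` {4..N})"
  have meet: "S \<inter> T \<noteq> {}" if "S \<in> triangle" "T \<in> triangle" for S T
  proof
    assume "S \<inter> T = {}"
    then have "card (S \<union> T) = 4"
      using that by (subst card_Un_disjoint) (auto simp: triangle_def intro: finite_subset)
    moreover have "card (S \<union> T) \<le> card {1..3::nat}"
      using that by (intro card_mono) (auto simp: triangle_def)
    ultimately show False by simp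
  qed
  have "is_clique (johnson_graph N 2) triangle"
    unfolding is_clique_johnson_graph_2_iff
    using meet assms by (fastforce simp: triangle_def)
  moreover have "is_clique (johnson_graph N 2) (star a)" for a
    by (auto simp: is_clique_johnson_graph_2_iff star_def)
  moreover have "S \<in> \<Union>C" if "S \<subseteq> {1..N}" "card S = 2" for S
  proof (cases "S \<subseteq> {1..3}")
    case True
    then show ?thesis using that by (auto simp: C_def triangle_def)
  next
    case False
    then obtain a where "a \<in> S" "a \<notin> {1..3}" by blast
    then show ?thesis using that by (force simp: C_def star_def)
  qed
  then have "pverts (johnson_graph N 2) \<subseteq> \<Union>C"
    by (auto simp: johnson_graph_def)
  ultimately have "is_clique_cover (johnson_graph N 2) C"
    by (auto simp: is_clique_cover_def is_clique_def C_def)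
  \<comment> \<open>There are at most \<open>N - 3\<close> stars, none if \<open>N = 3\<close>, and
    one triangle.\<close>
  moreover have "card C \<le> Suc (card (star ` {4..N}))"
    unfolding C_def by (rule card_insert_le_m1) simp_all
  then have "card C \<le> N - 2"
    using card_image_le[of "{4..N}" star] assms by simp
  ultimately show ?thesis by (auto simp: C_def)
qed

theorem theorem2p3:
  fixes N :: nat
  assumes "N > 2"
  shows "\<theta> (johnson_graph N 2) = N - 2"
proof (rule antisym)
  obtain C where "is_clique_cover (johnson_graph N 2) C" "finite C" "card C \<le> N - 2"
    using clique_cover_johnson_graph_2_exists[OF assms] by blast
  then show "\<theta> (johnson_graph N 2) \<le> N - 2"
    unfolding clique_cover_number_def by (intro Least_le[THEN le_trans]) auto
next
  \<comment> \<open>This supplies finiteness of the vertex set, so that \<open>\<theta>\<close> is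
    attained by a finite cover.\<close>
  interpret pair_graph "johnson_graph N 2"
    by (rule pair_graph_johnson_graph) simp
  show "N - 2 \<le> \<theta> (johnson_graph N 2)"
    using clique_cover_number_attained[of "johnson_graph N 2"]
      clique_cover_johnson_graph_2_card_ge by fastforce
qed

end
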